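(* Let $Y_1,\dots,Y_n$ be jointly Gaussian and pairwise uncorrelated, with means $\mu_1,\dots,\mu_n$ and variances $\sigma_1^2,\dots,\sigma_n^2$. Let $$\Omega=\{x\in\{0,1\}^{2\times n}: x_{1,j}+x_{2,j}=1 \text{ for all } j=1,\dots,n\}$$ and $Z_i(x)=\sum_{j=1}^n Y_j x_{i,j}$ for $i=1,2$. Then the stochastic makespan problem $$\min_{x\in\Omega}\ \mathbb{E}\big[\max\{Z_1(x),Z_2(x)\}\big]$$ is equivalent to the deterministic makespan problem $$\min_{x\in\Omega}\ \max\Big\{\sum_{j=1}^n\mu_j x_{1,j},\ \sum_{j=1}^n\mu_j x_{2,j}\Big\},$$ in the sense that an assignment $x\in\Omega$ is optimal for the first problem if and only if it is optimal for the second.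
   Context: The first problem is the scheduling problem written $P2|p\sim\mathcal N(\mu,\Sigma),\rho_{j,j'}=0|\mathbb{E}[C_{max}]$: partition $n$ jobs with uncorrelated jointly Gaussian processing times $Y_j$ between two identical parallel machines so as to minimize the expected makespan; $x_{i,j}=1$ means that job $j$ is assigned to machine $i$. The second is $P2|p_j=\mu_j|C_{max}$, its deterministic counterpart in which each processing time is replaced by its mean. *)

theory Defs
  imports "HOL-Probability.Probability"
begin

definition covariance :: "'a measure \<Rightarrow> ('a \<Rightarrow> real) \<Rightarrow> ('a \<Rightarrow> real) \<Rightarrow> real" where
  "covariance M X Y =
     prob_space.expectation M
       (\<lambda>\<omega>. (X \<omega> - prob_space.expectation M X) * (Y \<omega> - prob_space.expectation M Y))"

(* The degenerate normal distribution (s = 0), the point mass at m, is included. It needs its own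
   case because distributed with normal_density m 0, which is constantly 0, is impossible on a probability space. *)
definition gaussian_rv :: "'a measure \<Rightarrow> ('a \<Rightarrow> real) \<Rightarrow> real \<Rightarrow> real \<Rightarrow> bool" where
  "gaussian_rv M X m s \<longleftrightarrow>
     s > 0 \<and> distributed M lborel X (normal_density m s) \<or>
     s = 0 \<and> X \<in> borel_measurable M \<and> distr M borel X = return borel m"

(* The standard definition by linear combinations, which also covers singular covariance matrices.
   A unit vector c yields that each Y j is itself a Gaussian random variable. *)
definition jointly_gaussian :: "'a measure \<Rightarrow> 'i set \<Rightarrow> ('i \<Rightarrow> 'a \<Rightarrow> real) \<Rightarrow> bool" where
  "jointly_gaussian M J Y \<longleftrightarrow>
     (\<forall>c. \<exists>m s. gaussian_rv M (\<lambda>\<omega>. \<Sum>j\<in>J. c j * Y j \<omega>) m s)"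

(* Extensional functions, so that elements correspond exactly to 2 x n matrices over {0,1}. *)
definition assignments :: "nat \<Rightarrow> (nat \<Rightarrow> nat \<Rightarrow> real) set" where
  "assignments n = {x \<in> {1..2} \<rightarrow>\<^sub>E ({1..n} \<rightarrow>\<^sub>E {0, 1}). \<forall>j\<in>{1..n}. x 1 j + x 2 j = 1}"

definition machine_load :: "nat \<Rightarrow> (nat \<Rightarrow> real) \<Rightarrow> (nat \<Rightarrow> nat \<Rightarrow> real) \<Rightarrow> nat \<Rightarrow> real" where
  "machine_load n p x i = (\<Sum>j = 1..n. p j * x i j)"

definition makespan :: "nat \<Rightarrow> (nat \<Rightarrow> real) \<Rightarrow> (nat \<Rightarrow> nat \<Rightarrow> real) \<Rightarrow> real" where
  "makespan n p x = max (machine_load n p x 1) (machine_load n p x 2)"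

definition expected_makespan ::
    "'a measure \<Rightarrow> nat \<Rightarrow> (nat \<Rightarrow> 'a \<Rightarrow> real) \<Rightarrow> (nat \<Rightarrow> nat \<Rightarrow> real) \<Rightarrow> real" where
  "expected_makespan M n Y x =
     prob_space.expectation M (\<lambda>\<omega>. makespan n (\<lambda>j. Y j \<omega>) x)"

end

theory Submission
  imports Defs
begin

text \<open>
  Since max a b = (a + b) / 2 + |a - b| / 2 and the total load does not depend on the assignment,
  both problems amount to minimising a function of the imbalance D: the expectation of |D| in one
  case, the absolute value of the mean of D in the other. The imbalance is a sum of the job times
  with signs, so by uncorrelatedness its variance is the same for all assignments. Averaging
  |m + T| and |m - T| over a centred normal T shows that a normal variable m + T has expected
  absolute value E (max |m| |T|), and this is strictly increasing in |m|.
\<close>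

section \<open>Moments of a possibly degenerate Gaussian variable\<close>

text \<open>Turns the point-mass law into almost sure constancy, by which the degenerate cases below
  are settled.\<close>

lemma gaussian_rv_zero_AE:
  fixes X :: "'a \<Rightarrow> real"
  assumes "prob_space M" "X \<in> borel_measurable M" "distr M borel X = return borel m"
  shows "AE \<omega> in M. X \<omega> = m"
proof -
  have "AE x in distr M borel X. x = m"
    unfolding assms(3) by (subst AE_return) auto
  then show ?thesis
    using assms(2) by (subst (asm) AE_distr_iff) auto
qed

lemma gaussian_rv_measurable:
  "gaussian_rv M X m s \<Longrightarrow> X \<in> borel_measurable M"
  unfolding gaussian_rv_def by (auto dest: distributed_measurable)

lemma gaussian_rv_integrable_square:
  assumes "prob_space M" "gaussian_rv M X m s"
  shows "integrable M (\<lambda>\<omega>. (X \<omega>)\<^sup>2)"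
proof -
  interpret prob_space M by fact
  note [measurable] = gaussian_rv_measurable[OF assms(2)]
  from assms(2) consider (pos) "s > 0" "distributed M lborel X (normal_density m s)"
    | (zero) "distr M borel X = return borel m"
    unfolding gaussian_rv_def by blast
  then show ?thesis
  proof cases
    case pos
    have "integrable lborel (\<lambda>x. normal_density m s x * (x - m) ^ 2)"
      using pos(1) by (rule integrable_normal_moment)
    then have "integrable M (\<lambda>\<omega>. (X \<omega> - m) ^ 2)"
      by (subst (asm) distributed_integrable[OF pos(2)]) auto
    moreover have "integrable lborel (\<lambda>x. normal_density m s x * (x - m) ^ 1)"
      using pos(1) by (rule integrable_normal_moment)
    then have "integrable M (\<lambda>\<omega>. (X \<omega> - m) ^ 1)"
      by (subst (asm) distributed_integrable[OF pos(2)]) auto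
    \<comment> \<open>Expanding around the mean, this integrand is the square of \<open>X\<close>,
      so the central moments of orders 1 and 2 suffice.\<close>
    ultimately have "integrable M (\<lambda>\<omega>. (X \<omega> - m) ^ 2 + 2 * m * (X \<omega> - m) ^ 1 + m\<^sup>2)"
      by auto
    then show ?thesis
      by (simp add: power2_eq_square algebra_simps)
  next
    case zero
    then have "AE \<omega> in M. X \<omega> = m"
      using assms(1) by (intro gaussian_rv_zero_AE) auto
    then have "AE \<omega> in M. m\<^sup>2 = (X \<omega>)\<^sup>2"
      by eventually_elim simp
    then show ?thesis
      by (rule integrable_cong_AE_imp[rotated 2]) (simp, measurable)
  qed
qed

text \<open>Joint Gaussianity only asserts that some parameters exist for a linear combination; this
  lets them be recovered from its mean and variance.\<close>

lemma gaussian_rv_expectation_variance: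
  assumes "prob_space M" "gaussian_rv M X m s"
  shows "prob_space.expectation M X = m" and "prob_space.variance M X = s\<^sup>2"
proof -
  interpret prob_space M by fact
  note [measurable] = gaussian_rv_measurable[OF assms(2)]
  from assms(2) consider (pos) "s > 0" "distributed M lborel X (normal_density m s)"
    | (zero) "s = 0" "distr M borel X = return borel m"
    unfolding gaussian_rv_def by blast
  then have "expectation X = m \<and> variance X = s\<^sup>2"
  proof cases
    case pos
    then show ?thesis
      using normal_distributed_expectation normal_distributed_variance by blast
  next
    case zero
    then have AE: "AE \<omega> in M. X \<omega> = m"
      using assms(1) by (intro gaussian_rv_zero_AE) auto
    have "expectation X = expectation (\<lambda>_. m)"
      using AE by (intro integral_cong_AE) auto
    then have m: "expectation X = m" by (simp add: prob_space)
    have "AE \<omega> in M. (X \<omega> - m)\<^sup>2 = 0"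
      using AE by eventually_elim simp
    then have "expectation (\<lambda>\<omega>. (X \<omega> - m)\<^sup>2) = expectation (\<lambda>_. 0)"
      by (intro integral_cong_AE) auto
    then show ?thesis using m zero by simp
  qed
  then show "expectation X = m" "variance X = s\<^sup>2" by auto
qed

section \<open>Mean absolute value of a Gaussian variable\<close>

text \<open>For \<open>a \<ge> 0\<close> and \<open>s \<ge> 0\<close> this is the mean of the folded
  normal distribution, the law of the absolute value of a normal variable with mean \<open>a\<close>
  and standard deviation \<open>s\<close>. In this form the integrand is visibly monotone in
  \<open>a\<close>. The case \<open>s = 0\<close> is separate because
  \<open>normal_density 0 0\<close> vanishes, so the integral would be 0 instead of
  \<open>a\<close>.\<close>

definition folded_mean :: "real \<Rightarrow> real \<Rightarrow> real" where
  "folded_mean s a =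
     (if s = 0 then a else \<integral>t. normal_density 0 s t * max a \<bar>t\<bar> \<partial>lborel)"

lemma integrable_normal_density_abs:
  assumes "s > 0"
  shows "integrable lborel (\<lambda>t. normal_density 0 s t * \<bar>t\<bar>)"
proof -
  have "integrable lborel (\<lambda>t. normal_density 0 s t * \<bar>t - 0\<bar> ^ 1)"
    using assms by (rule integrable_normal_moment_abs)
  then show ?thesis by simp
qed

text \<open>Functions of at most linear growth are integrable against the density because the first
  absolute moment is finite. This serves both the maximum in \<open>folded_mean\<close> and the
  shifted absolute values averaged later.\<close>

lemma integrable_normal_density_dominated:
  fixes f :: "real \<Rightarrow> real"
  assumes "s > 0" "f \<in> borel_measurable borel" "\<And>t. \<bar>f t\<bar> \<le> a + \<bar>t\<bar>"
  shows "integrable lborel (\<lambda>t. normal_density 0 s t * f t)"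
proof (rule Bochner_Integration.integrable_bound)
  show "integrable lborel (\<lambda>t. a * normal_density 0 s t + normal_density 0 s t * \<bar>t\<bar>)"
    using assms(1) integrable_normal_density_abs by auto
  have "norm (normal_density 0 s t * f t) \<le> norm (a * normal_density 0 s t + normal_density 0 s t * \<bar>t\<bar>)" for t
  proof -
    have "norm (normal_density 0 s t * f t) = normal_density 0 s t * \<bar>f t\<bar>"
      by (simp add: abs_mult)
    also have "\<dots> \<le> normal_density 0 s t * (a + \<bar>t\<bar>)"
      using assms(3) by (intro mult_left_mono) auto
    also have "\<dots> \<le> norm (a * normal_density 0 s t + normal_density 0 s t * \<bar>t\<bar>)"
      by (simp add: algebra_simps)
    finally show ?thesis .
  qed
  then show "AE t in lborel. norm (normal_density 0 s t * f t) \<le> norm (a * normal_density 0 s t + normal_density 0 s t * \<bar>t\<bar>)"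
    by simp
qed (use assms(2) in measurable)

text \<open>For \<open>s > 0\<close> the integrands are ordered pointwise, and strictly so on the
  open interval from \<open>-b\<close> to \<open>b\<close>: there the larger maximum equals
  \<open>b\<close>, the smaller stays below \<open>b\<close>, and the density is positive. Equal
  integrals would make this interval a null set, although its length is
  \<open>2 * b > 0\<close>.\<close>

lemma folded_mean_strict_mono:
  assumes "s \<ge> 0" "0 \<le> a" "a < b"
  shows "folded_mean s a < folded_mean s b"
proof (cases "s = 0")
  case True
  then show ?thesis using assms by (simp add: folded_mean_def)
next
  case False
  with assms have s: "s > 0" by simp
  let ?g = "\<lambda>c t. normal_density 0 s t * max c \<bar>t\<bar>"
  have int: "integrable lborel (?g c)" if "c \<ge> 0" for c
    using s that by (intro integrable_normal_density_dominated[where a = c]) auto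
  have le: "?g a t \<le> ?g b t" for t
    using assms(3) by (intro mult_left_mono max.mono) simp_all
  have "(\<integral>t. ?g a t \<partial>lborel) \<noteq> (\<integral>t. ?g b t \<partial>lborel)"
  proof
    assume "(\<integral>t. ?g a t \<partial>lborel) = (\<integral>t. ?g b t \<partial>lborel)"
    then have "(\<integral>t. ?g b t - ?g a t \<partial>lborel) = 0"
      using int[of a] int[of b] assms by simp
    then have "AE t in lborel. ?g b t - ?g a t = 0"
      using int[of a] int[of b] assms le by (subst (asm) integral_nonneg_eq_0_iff_AE) auto
    then have "AE t in lborel. t \<notin> {-b<..<b}"
    proof eventually_elim
      fix t assume "?g b t - ?g a t = 0"
      then have "max a \<bar>t\<bar> = max b \<bar>t\<bar>"
        using normal_density_pos[OF s, of 0 t] by simp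
      then show "t \<notin> {-b<..<b}" using assms(3) by auto
    qed
    then have "{-b<..<b} \<in> null_sets lborel"
      by (subst AE_iff_null_sets) auto
    then show False using assms by (simp add: null_sets_def)
  qed
  moreover have "(\<integral>t. ?g a t \<partial>lborel) \<le> (\<integral>t. ?g b t \<partial>lborel)"
    using int assms le by (intro integral_mono) auto
  ultimately have "(\<integral>t. ?g a t \<partial>lborel) < (\<integral>t. ?g b t \<partial>lborel)"
    by simp
  then show ?thesis using False by (simp add: folded_mean_def)
qed

lemma gaussian_rv_expectation_abs:
  assumes "prob_space M" "gaussian_rv M X m s"
  shows "prob_space.expectation M (\<lambda>\<omega>. \<bar>X \<omega>\<bar>) = folded_mean s \<bar>m\<bar>"
proof -
  interpret prob_space M by fact
  note [measurable] = gaussian_rv_measurable[OF assms(2)]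
  from assms(2) consider (pos) "s > 0" "distributed M lborel X (normal_density m s)"
    | (zero) "s = 0" "distr M borel X = return borel m"
    unfolding gaussian_rv_def by blast
  then show ?thesis
  proof cases
    case pos
    have sym: "normal_density 0 s (- t) = normal_density 0 s t" for t
      by (simp add: normal_density_def)
    let ?I = "\<lambda>f. (\<integral>t. normal_density 0 s t * f t \<partial>lborel)"
    have int: "integrable lborel (\<lambda>t. normal_density 0 s t * \<bar>m + t\<bar>)"
      "integrable lborel (\<lambda>t. normal_density 0 s t * \<bar>m - t\<bar>)"
      using pos(1) by (intro integrable_normal_density_dominated[where a = "\<bar>m\<bar>"]; simp; linarith)+
    have "expectation (\<lambda>\<omega>. \<bar>X \<omega>\<bar>) = (\<integral>t. normal_density m s t * \<bar>t\<bar> \<partial>lborel)"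
      by (rule distributed_integral[OF pos(2), symmetric]) auto
    \<comment> \<open>Translation by the mean centres the density; the reflection used next
      preserves the centred density by \<open>sym\<close>.\<close>
    also have "\<dots> = (\<integral>t. normal_density m s (m + 1 * t) * \<bar>m + 1 * t\<bar> \<partial>lborel)"
      by (subst lborel_integral_real_affine[where t = m and c = 1]) auto
    also have "\<dots> = ?I (\<lambda>t. \<bar>m + t\<bar>)"
      by (simp add: normal_density_def)
    finally have 1: "expectation (\<lambda>\<omega>. \<bar>X \<omega>\<bar>) = ?I (\<lambda>t. \<bar>m + t\<bar>)" .
    also have "\<dots> = ?I (\<lambda>t. \<bar>m - t\<bar>)"
      by (subst lborel_integral_real_affine[where t = 0 and c = "-1"]) (auto simp: sym)
    finally have 2: "expectation (\<lambda>\<omega>. \<bar>X \<omega>\<bar>) = ?I (\<lambda>t. \<bar>m - t\<bar>)" .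
    have "2 * expectation (\<lambda>\<omega>. \<bar>X \<omega>\<bar>) = ?I (\<lambda>t. \<bar>m + t\<bar>) + ?I (\<lambda>t. \<bar>m - t\<bar>)"
      using 1 2 by simp
    also have "\<dots> = (\<integral>t. normal_density 0 s t * \<bar>m + t\<bar> + normal_density 0 s t * \<bar>m - t\<bar> \<partial>lborel)"
      using int by (rule Bochner_Integration.integral_add[symmetric])
    also have "\<dots> = (\<integral>t. 2 * (normal_density 0 s t * max \<bar>m\<bar> \<bar>t\<bar>) \<partial>lborel)"
    proof (rule Bochner_Integration.integral_cong[OF refl])
      fix t :: real
      \<comment> \<open>In some order, the two summands are the absolute values of the sum and of
        the difference of \<open>\<bar>m\<bar>\<close> and \<open>\<bar>t\<bar>\<close>; together
        they give twice the larger of the two.\<close>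
      have "\<bar>m + t\<bar> + \<bar>m - t\<bar> = 2 * max \<bar>m\<bar> \<bar>t\<bar>" by linarith
      then show "normal_density 0 s t * \<bar>m + t\<bar> + normal_density 0 s t * \<bar>m - t\<bar> =
          2 * (normal_density 0 s t * max \<bar>m\<bar> \<bar>t\<bar>)"
        by (metis distrib_left mult.left_commute)
    qed
    finally show ?thesis using pos(1) by (simp add: folded_mean_def)
  next
    case zero
    then have "AE \<omega> in M. X \<omega> = m"
      using assms(1) by (intro gaussian_rv_zero_AE) auto
    then have "AE \<omega> in M. \<bar>X \<omega>\<bar> = \<bar>m\<bar>"
      by eventually_elim simp
    then have "expectation (\<lambda>\<omega>. \<bar>X \<omega>\<bar>) = expectation (\<lambda>_. \<bar>m\<bar>)"
      by (intro integral_cong_AE) auto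
    then show ?thesis using zero by (simp add: folded_mean_def prob_space)
  qed
qed

section \<open>Linear combinations of the job times\<close>

text \<open>Bienayme's identity: after centring, the square of the sum expands into a double sum
  whose off-diagonal expectations are covariances. Square integrability makes every product
  integrable, so the expectation may be taken termwise.\<close>

lemma variance_sum_uncorrelated:
  assumes "prob_space M" "finite J"
    and meas: "\<And>j. j \<in> J \<Longrightarrow> Y j \<in> borel_measurable M"
    and sq: "\<And>j. j \<in> J \<Longrightarrow> integrable M (\<lambda>\<omega>. (Y j \<omega>)\<^sup>2)"
    and uncorr: "\<And>i j. i \<in> J \<Longrightarrow> j \<in> J \<Longrightarrow> i \<noteq> j \<Longrightarrow> covariance M (Y i) (Y j) = 0"
  shows "prob_space.variance M (\<lambda>\<omega>. \<Sum>j\<in>J. c j * Y j \<omega>) =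
    (\<Sum>j\<in>J. (c j)\<^sup>2 * prob_space.variance M (Y j))"
proof -
  interpret prob_space M by fact
  define U where "U j \<omega> = Y j \<omega> - expectation (Y j)" for j \<omega>
  have int: "integrable M (Y j)" if "j \<in> J" for j
    using square_integrable_imp_integrable[OF meas sq] that by simp
  have U2: "integrable M (\<lambda>\<omega>. (U j \<omega>)\<^sup>2)" if "j \<in> J" for j
    unfolding U_def power2_diff using int sq that by auto
  have Um: "U j \<in> borel_measurable M" if "j \<in> J" for j
    unfolding U_def using meas[OF that] by measurable
  have UU: "integrable M (\<lambda>\<omega>. U i \<omega> * U j \<omega>)" if "i \<in> J" "j \<in> J" for i j
  proof (rule Bochner_Integration.integrable_bound)
    show "integrable M (\<lambda>\<omega>. (U i \<omega>)\<^sup>2 + (U j \<omega>)\<^sup>2)" using U2 that by auto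
    show "(\<lambda>\<omega>. U i \<omega> * U j \<omega>) \<in> borel_measurable M"
      using Um that by (intro borel_measurable_times)
    have "norm (u * v) \<le> norm (u\<^sup>2 + v\<^sup>2)" for u v :: real
    proof -
      have "2 * \<bar>u\<bar> * \<bar>v\<bar> \<le> \<bar>u\<bar>\<^sup>2 + \<bar>v\<bar>\<^sup>2" by (rule sum_squares_bound)
      moreover have "0 \<le> \<bar>u\<bar> * \<bar>v\<bar>" by simp
      ultimately show ?thesis
        unfolding real_norm_def abs_mult power2_abs by linarith
    qed
    then show "AE \<omega> in M. norm (U i \<omega> * U j \<omega>) \<le> norm ((U i \<omega>)\<^sup>2 + (U j \<omega>)\<^sup>2)" by simp
  qed
  have cov: "expectation (\<lambda>\<omega>. U i \<omega> * U j \<omega>) = (if i = j then variance (Y j) else 0)"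
    if "i \<in> J" "j \<in> J" for i j
    using uncorr[OF that] unfolding covariance_def U_def by (auto simp: power2_eq_square)
  have "variance (\<lambda>\<omega>. \<Sum>j\<in>J. c j * Y j \<omega>) = expectation (\<lambda>\<omega>. (\<Sum>j\<in>J. c j * U j \<omega>)\<^sup>2)"
    using int by (simp add: U_def right_diff_distrib sum_subtractf)
  also have "\<dots> = expectation (\<lambda>\<omega>. \<Sum>i\<in>J. \<Sum>j\<in>J. c i * c j * (U i \<omega> * U j \<omega>))"
    unfolding power2_eq_square sum_product by (simp only: mult_ac)
  also have "\<dots> = (\<Sum>i\<in>J. \<Sum>j\<in>J. c i * c j * expectation (\<lambda>\<omega>. U i \<omega> * U j \<omega>))"
    using UU by simp
  also have "\<dots> = (\<Sum>i\<in>J. \<Sum>j\<in>J. if i = j then c i * c j * variance (Y j) else 0)"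
    by (intro sum.cong refl) (simp add: cov)
  also have "\<dots> = (\<Sum>j\<in>J. (c j)\<^sup>2 * variance (Y j))"
    using assms(2) by (simp add: power2_eq_square)
  finally show ?thesis .
qed

text \<open>Source of the measurability and square integrability of the individual job times in the
  theorem.\<close>

lemma jointly_gaussian_component:
  assumes "jointly_gaussian M J Y" "finite J" "j \<in> J"
  obtains m s where "gaussian_rv M (Y j) m s"
proof -
  obtain m s where "gaussian_rv M (\<lambda>\<omega>. \<Sum>k\<in>J. (if k = j then 1 else 0) * Y k \<omega>) m s"
    using assms(1) unfolding jointly_gaussian_def by meson
  moreover have "(\<lambda>\<omega>. \<Sum>k\<in>J. (if k = j then 1 else 0) * Y k \<omega>) = Y j"
    using assms(2,3) by (simp add: if_distrib[of "\<lambda>c. c * _"] cong: if_cong)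
  ultimately show ?thesis using that by simp
qed

section \<open>Assignments and the load imbalance\<close>

text \<open>Applied twice: with \<open>p\<close> the realised job times at each outcome, and with
  \<open>p\<close> the means. In both cases \<open>x\<close> enters only through the absolute
  imbalance.\<close>

lemma makespan_imbalance:
  assumes "x \<in> assignments n"
  shows "makespan n p x = (\<Sum>j = 1..n. p j) / 2 + \<bar>\<Sum>j = 1..n. (x 1 j - x 2 j) * p j\<bar> / 2"
proof -
  have "machine_load n p x 1 + machine_load n p x 2 = (\<Sum>j = 1..n. p j * (x 1 j + x 2 j))"
    by (simp add: machine_load_def sum.distrib distrib_left)
  also have "\<dots> = (\<Sum>j = 1..n. p j)"
    using assms by (intro sum.cong) (auto simp: assignments_def)
  finally have "machine_load n p x 1 + machine_load n p x 2 = (\<Sum>j = 1..n. p j)" .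
  moreover have "machine_load n p x 1 - machine_load n p x 2 = (\<Sum>j = 1..n. (x 1 j - x 2 j) * p j)"
    by (simp add: machine_load_def sum_subtractf algebra_simps)
  ultimately show ?thesis unfolding makespan_def by linarith
qed

text \<open>The coefficients of the imbalance are signs, which is why its variance is the same for
  all assignments.\<close>

lemma assignments_sign_square:
  assumes "x \<in> assignments n" "j \<in> {1..n}"
  shows "(x 1 j - x 2 j)\<^sup>2 = 1"
proof -
  have "x 1 j + x 2 j = 1" "x 1 \<in> {1..n} \<rightarrow>\<^sub>E {0, 1}"
    using assms by (auto simp: assignments_def)
  moreover from this(2) have "x 1 j \<in> {0, 1}" using assms(2) by (rule PiE_mem)
  ultimately show ?thesis by auto
qed

theorem theorem2:
  fixes M :: "'a measure" and n :: nat
    and Y :: "nat \<Rightarrow> 'a \<Rightarrow> real" and \<mu> \<sigma> :: "nat \<Rightarrow> real"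
  assumes "prob_space M"
    and "jointly_gaussian M {1..n} Y"
    and "\<And>j. j \<in> {1..n} \<Longrightarrow> prob_space.expectation M (Y j) = \<mu> j"
    and "\<And>j. j \<in> {1..n} \<Longrightarrow> prob_space.variance M (Y j) = (\<sigma> j)\<^sup>2"
    and "\<And>i j. i \<in> {1..n} \<Longrightarrow> j \<in> {1..n} \<Longrightarrow> i \<noteq> j \<Longrightarrow> covariance M (Y i) (Y j) = 0"
  shows "\<forall>x \<in> assignments n.
           is_arg_min (expected_makespan M n Y) (\<lambda>y. y \<in> assignments n) x \<longleftrightarrow>
           is_arg_min (makespan n \<mu>) (\<lambda>y. y \<in> assignments n) x"
proof -
  interpret prob_space M by fact
  \<comment> \<open>For an assignment \<open>x\<close>, \<open>D x\<close> is the random imbalance,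
    \<open>d x\<close> its mean and \<open>s\<close> its standard deviation; \<open>s\<close> does
    not depend on \<open>x\<close>.\<close>
  define D where "D x \<omega> = (\<Sum>j = 1..n. (x 1 j - x 2 j) * Y j \<omega>)" for x :: "nat \<Rightarrow> nat \<Rightarrow> real" and \<omega>
  define d where "d x = (\<Sum>j = 1..n. (x 1 j - x 2 j) * \<mu> j)" for x :: "nat \<Rightarrow> nat \<Rightarrow> real"
  define s where "s = sqrt (\<Sum>j = 1..n. (\<sigma> j)\<^sup>2)"
  have meas: "Y j \<in> borel_measurable M" and sq: "integrable M (\<lambda>\<omega>. (Y j \<omega>)\<^sup>2)"
    if "j \<in> {1..n}" for j
    using jointly_gaussian_component[OF assms(2) _ that] gaussian_rv_measurable
      gaussian_rv_integrable_square[OF assms(1)] by (metis finite_atLeastAtMost)+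
  have int: "integrable M (Y j)" if "j \<in> {1..n}" for j
    using square_integrable_imp_integrable[OF meas sq] that by simp
  have intD: "integrable M (D x)" for x
    unfolding D_def using int by auto
  have gauss: "gaussian_rv M (D x) (d x) s" if x: "x \<in> assignments n" for x
  proof -
    obtain m r where g: "gaussian_rv M (D x) m r"
      using assms(2) unfolding jointly_gaussian_def D_def by meson
    have "m = expectation (D x)"
      using gaussian_rv_expectation_variance(1)[OF assms(1) g] by simp
    also have "\<dots> = d x"
      unfolding D_def d_def using int assms(3) by simp
    finally have m: "m = d x" .
    have "r\<^sup>2 = variance (D x)"
      using gaussian_rv_expectation_variance(2)[OF assms(1) g] by simp
    also have "\<dots> = (\<Sum>j = 1..n. (x 1 j - x 2 j)\<^sup>2 * variance (Y j))"
      unfolding D_def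
      by (rule variance_sum_uncorrelated[OF assms(1) _ meas sq assms(5)]) auto
    also have "\<dots> = (\<Sum>j = 1..n. (\<sigma> j)\<^sup>2)"
      using assignments_sign_square[OF x] assms(4) by (intro sum.cong) auto
    finally have "r\<^sup>2 = (\<Sum>j = 1..n. (\<sigma> j)\<^sup>2)" .
    \<comment> \<open>The variance determines \<open>r\<close> only up to sign; the nonnegativity
      built into \<open>gaussian_rv\<close> selects the root \<open>s\<close>.\<close>
    moreover have "r \<ge> 0" using g unfolding gaussian_rv_def by auto
    ultimately have "r = s" unfolding s_def by (metis real_sqrt_unique)
    with g m show ?thesis by simp
  qed
  have s: "s \<ge> 0" unfolding s_def by (simp add: sum_nonneg)
  have E: "expected_makespan M n Y x = expectation (\<lambda>\<omega>. \<Sum>j = 1..n. Y j \<omega>) / 2 + folded_mean s \<bar>d x\<bar> / 2"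
    if x: "x \<in> assignments n" for x
  proof -
    have "expected_makespan M n Y x = expectation (\<lambda>\<omega>. (\<Sum>j = 1..n. Y j \<omega>) / 2 + \<bar>D x \<omega>\<bar> / 2)"
      unfolding expected_makespan_def makespan_imbalance[OF x] D_def ..
    also have "\<dots> = expectation (\<lambda>\<omega>. \<Sum>j = 1..n. Y j \<omega>) / 2 + expectation (\<lambda>\<omega>. \<bar>D x \<omega>\<bar>) / 2"
      using int intD
      by (subst Bochner_Integration.integral_add) (auto intro!: integrable_divide)
    finally show ?thesis
      by (simp add: gaussian_rv_expectation_abs[OF assms(1) gauss[OF x]])
  qed
  \<comment> \<open>\<open>is_arg_min\<close> says that no feasible point has a strictly smaller
    value, so it suffices that both objectives induce the same strict order on assignments.\<close>
  have "expected_makespan M n Y x < expected_makespan M n Y y \<longleftrightarrow> makespan n \<mu> x < makespan n \<mu> y"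
    if "x \<in> assignments n" "y \<in> assignments n" for x y
  proof -
    have "folded_mean s \<bar>d x\<bar> < folded_mean s \<bar>d y\<bar> \<longleftrightarrow> \<bar>d x\<bar> < \<bar>d y\<bar>"
      using folded_mean_strict_mono[OF s, of "\<bar>d x\<bar>" "\<bar>d y\<bar>"]
        folded_mean_strict_mono[OF s, of "\<bar>d y\<bar>" "\<bar>d x\<bar>"]
      by (cases "\<bar>d x\<bar>" "\<bar>d y\<bar>" rule: linorder_cases) auto
    then show ?thesis
      using that by (simp add: E makespan_imbalance d_def)
  qed
  then show ?thesis
    unfolding is_arg_min_def by blast
qed

end
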